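(* Let $0<\lambda<1$, and let $g$, $G$ and the exponential Bell polynomial values $B_{n,k}(g_\bullet)$, $g_\bullet=\left(\frac12,\frac13,\dots,\frac1{n+1},\dots\right)$, be as defined in the context. Then the Taylor series expansion of the function $G(s)$ in the neighborhood of $s=1$ is $$G(s)=\sum_{n=1}^\infty\frac{(\lambda(s-1))^n-(-\lambda)^n}{n}\,\frac{1}{n!}\sum_{k=1}^n\left(\frac{\lambda}{1-\lambda}\right)^k k!\,B_{n,k}(g_\bullet),$$ where $G(0)=0$ and $$G(1)=-\sum_{n=1}^\infty\frac{(-\lambda)^n}{n}\,\frac{1}{n!}\sum_{k=1}^n\left(\frac{\lambda}{1-\lambda}\right)^k k!\,B_{n,k}(g_\bullet),\qquad G^{(n)}(1)=\frac{\lambda^n}{n}\sum_{k=1}^n\left(\frac{\lambda}{1-\lambda}\right)^k k!\,B_{n,k}(g_\bullet)\quad(n\ge 1).$$ Equivalently, with $b_n=\lambda^n\sum_{k=1}^n\left(\frac{\lambda}{1-\lambda}\right)^k k!\,B_{n,k}(g_\bullet)$ for $n\ge1$, $$G(s)=G(1)+\sum_{n=1}^\infty\frac{b_n}{n}\,\frac{(s-1)^n}{n!},\qquad G(0)=0,\qquad G(1)=\sum_{n=1}^\infty\frac{(-1)^{n-1}b_n}{n\cdot n!}>0.$$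
   Context: Fix $0<\lambda<1$ (subcritical Markov branching process with Poisson offspring generating function $h(s)=e^{\lambda(s-1)}$). The function $g$ is $$g(x)=\frac{e^{\lambda(x-1)}-1-\lambda(x-1)}{(1-\lambda)(x-1)}=\frac{\lambda}{1-\lambda}\sum_{n=1}^\infty\frac{\lambda^n}{n+1}\,\frac{(x-1)^n}{n!},\qquad g(1)=0,$$ so that $$\frac{\lambda-1}{e^{\lambda(x-1)}-x}=\frac{1}{(x-1)(1-g(x))}.$$ The Koenigs function is $$B(s)=\exp\left(\int_0^s\frac{(\lambda-1)\,dx}{e^{\lambda(x-1)}-x}\right),\quad 0\le s<1,$$ with $B(0)=1$ and $B(1)=0$. The function $G$ is defined by $B(s)=(1-s)e^{G(s)}$, i.e. $G(s)=\log\frac{B(s)}{1-s}$, equivalently $$G(s)=\int_0^s\frac{1}{x-1}\left(\frac{1}{1-g(x)}-1\right)dx$$ (the paper writes $\frac{1}{1-g(x)}-1=\sum_{k\ge1}g(x)^k$). The integrand has a removable singularity at $x=1$, and this integral defines $G$ at $s=1$ and in a neighborhood of $s=1$. For a sequence $x_\bullet=(x_1,x_2,\dots)$, the (partial) exponential Bell polynomials $B_{n,k}(x_\bullet)$ are defined by $$\frac{1}{k!}\left(\sum_{m\ge1}x_m\frac{u^m}{m!}\right)^k=\sum_{n\ge k}B_{n,k}(x_\bullet)\frac{u^n}{n!}$$ as formal power series in $u$.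
   Formalization: The first expansion of G(s) and both series formulas for G(1) are stated only for λ ≤ ln 2, since for ln 2 < λ < 1 the series Σ(-λ)^n/(n·n!)·Σ_k(...) diverges; everything else, including G(1)>0, holds for all 0<λ<1. *)

theory Defs
  imports "HOL-Analysis.Analysis" "HOL-Computational_Algebra.Formal_Power_Series"
begin

text \<open>Throughout, \<open>l\<close> is the parameter of the Poisson offspring law, \<open>0 < l < 1\<close>.\<close>

definition bell_poly :: "nat \<Rightarrow> nat \<Rightarrow> (nat \<Rightarrow> real) \<Rightarrow> real" where
  "bell_poly n k x =
     fact n * fps_nth (fps_const (1 / fact k) * Abs_fps (\<lambda>m. if m = 0 then 0 else x m / fact m) ^ k) n"

definition g_seq :: "nat \<Rightarrow> real" where
  "g_seq m = 1 / (real m + 1)"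

definition bell_sum :: "real \<Rightarrow> nat \<Rightarrow> real" where
  "bell_sum l n = (\<Sum>k=1..n. (l / (1 - l)) ^ k * fact k * bell_poly n k g_seq)"

definition b_coeff :: "real \<Rightarrow> nat \<Rightarrow> real" where
  "b_coeff l n = l ^ n * bell_sum l n"

definition g_fun :: "real \<Rightarrow> real \<Rightarrow> real" where
  "g_fun l x = (if x = 1 then 0
     else (exp (l * (x - 1)) - 1 - l * (x - 1)) / ((1 - l) * (x - 1)))"

definition koenigs :: "real \<Rightarrow> real \<Rightarrow> real" where
  "koenigs l s = exp (integral {0..s} (\<lambda>x. (l - 1) / (exp (l * (x - 1)) - x)))"

text \<open>At its removable singularity \<open>x = 1\<close> the integrand takes the junk value \<open>0\<close>, which does not
  affect the integral. The definition is meaningful for \<open>0 \<le> s < q\<close>, where \<open>q > 1\<close> is the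
  root of \<open>exp (l * (q - 1)) = q\<close>; in particular in a neighbourhood of \<open>1\<close>. The relation
  with the Koenigs function is lemma \<open>koenigs_eq\<close>.\<close>

definition G_fun :: "real \<Rightarrow> real \<Rightarrow> real" where
  "G_fun l s = integral {0..s} (\<lambda>x. 1 / (x - 1) * (1 / (1 - g_fun l x) - 1))"

lemma exp_gt_left_of_one:
  fixes l x :: real
  assumes "0 < l" "l < 1" "x < 1"
  shows "x < exp (l * (x - 1))"
proof -
  have "x < 1 + l * (x - 1)"
    using mult_strict_right_mono_neg[of l 1 "x - 1"] assms by (simp add: algebra_simps)
  also have "\<dots> \<le> exp (l * (x - 1))" by (rule exp_ge_add_one_self)
  finally show ?thesis .
qed

lemma koenigs_integrand_eq:
  fixes l x :: real
  assumes "0 < l" "l < 1" "x < 1"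
  shows "1 / (x - 1) * (1 / (1 - g_fun l x) - 1) = (l - 1) / (exp (l * (x - 1)) - x) - 1 / (x - 1)"
proof -
  have e: "exp (l * (x - 1)) - x \<noteq> 0" using exp_gt_left_of_one[OF assms] by simp
  have nz: "(1 - l) * (x - 1) \<noteq> 0" using assms by simp
  have "1 - g_fun l x = ((1 - l) * (x - 1) - (exp (l * (x - 1)) - 1 - l * (x - 1))) / ((1 - l) * (x - 1))"
    unfolding g_fun_def using nz assms by (simp add: diff_divide_distrib)
  also have "(1 - l) * (x - 1) - (exp (l * (x - 1)) - 1 - l * (x - 1)) = x - exp (l * (x - 1))"
    by (simp add: algebra_simps)
  finally have "1 / (x - 1) * (1 / (1 - g_fun l x)) = (1 - l) / (x - exp (l * (x - 1)))"
    using nz by simp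
  also have "\<dots> = (l - 1) / (exp (l * (x - 1)) - x)"
    by (metis minus_diff_eq minus_divide_divide)
  finally show ?thesis by (simp add: right_diff_distrib)
qed

lemma koenigs_eq:
  fixes l s :: real
  assumes "0 < l" "l < 1" "0 \<le> s" "s < 1"
  shows "koenigs l s = (1 - s) * exp (G_fun l s)"
proof -
  let ?K = "\<lambda>x. (l - 1) / (exp (l * (x - 1)) - x)"
  have ne: "exp (l * (x - 1)) - x \<noteq> 0" if "x \<in> {0..s}" for x
    using exp_gt_left_of_one[of l x] that assms by auto
  have K: "?K integrable_on {0..s}"
    by (rule integrable_continuous_real) (use ne in \<open>auto intro!: continuous_intros\<close>)
  have L: "((\<lambda>x. 1 / (x - 1)) has_integral (ln (1 - s) - ln (1 - 0))) {0..s}"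
  proof (rule fundamental_theorem_of_calculus)
    show "((\<lambda>x. ln (1 - x)) has_vector_derivative 1 / (x - 1)) (at x within {0..s})"
      if "x \<in> {0..s}" for x
      unfolding has_real_derivative_iff_has_vector_derivative[symmetric]
      using that assms by (auto intro!: derivative_eq_intros simp: field_simps)
  qed (use assms in simp)
  have "G_fun l s = integral {0..s} (\<lambda>x. ?K x - 1 / (x - 1))"
    unfolding G_fun_def
    by (rule Henstock_Kurzweil_Integration.integral_cong) (use assms koenigs_integrand_eq in auto)
  also have "\<dots> = integral {0..s} ?K - ln (1 - s)"
    using integral_unique[OF has_integral_diff[OF integrable_integral[OF K] L]] by simp
  finally show ?thesis
    unfolding koenigs_def using assms by (simp add: exp_diff)
qed

text \<open>The next lemma explains the hypothesis \<open>l \<le> ln 2\<close> on the series for \<open>G_fun l 1\<close>: their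
  terms are Taylor coefficients of \<open>G_fun l\<close> at \<open>1\<close>, evaluated at distance \<open>1\<close>, while the radius
  of convergence is \<open>q - 1\<close>, and \<open>q < 2\<close> for \<open>l > ln 2\<close>.\<close>

lemma not_summable_G1_series:
  fixes l :: real
  assumes l: "ln 2 < l" "l < 1"
  shows "\<not> summable (\<lambda>i. let n = Suc i in (- l) ^ n / real n * (1 / fact n) * bell_sum l n)"
proof
  assume S: "summable (\<lambda>i. let n = Suc i in (- l) ^ n / real n * (1 / fact n) * bell_sum l n)"
  have "0 < ln (2::real)" by simp
  with l have l0: "0 < l" by linarith
  define r where "r = l / (1 - l)"
  have r: "r > 0" using l l0 by (simp add: r_def)
  define F :: "real fps" where "F = Abs_fps (\<lambda>m. if m = 0 then 0 else g_seq m / fact m)"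
  define H where "H = fps_const r * F"
  define A where "A = Abs_fps (\<lambda>n. bell_sum l n / fact n)"
  have H_nth: "fps_nth H m = (if m = 0 then 0 else r / fact (Suc m))" for m
    by (simp add: H_def F_def g_seq_def field_simps)
  have Hpow0: "fps_nth (H ^ k) n = 0" if "n < k" for n k
    using that by (simp add: startsby_zero_power_prefix H_nth)
  have A_nth: "fps_nth A n = (\<Sum>k=1..n. fps_nth (H ^ k) n)" for n
    by (simp add: A_def bell_sum_def bell_poly_def H_def power_mult_distrib fps_const_power
        F_def[symmetric] r_def[symmetric] sum_divide_distrib)
  have A_nth': "fps_nth A n = (\<Sum>k=1..N. fps_nth (H ^ k) n)" if "n \<le> N" for n N
    unfolding A_nth by (rule sum.mono_neutral_left) (use that in \<open>auto simp: Hpow0\<close>)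
  have A_eq: "A = H + H * A"
  proof (rule fps_ext)
    fix n
    have "fps_nth (H * A) n = (\<Sum>i=0..n. fps_nth H i * (\<Sum>k=1..n. fps_nth (H ^ k) (n - i)))"
      by (simp add: fps_mult_nth A_nth'[of _ n])
    also have "\<dots> = (\<Sum>k=1..n. fps_nth (H ^ Suc k) n)"
      by (simp add: fps_mult_nth sum_distrib_left) (rule sum.swap)
    also have "\<dots> = (\<Sum>k=Suc 1..Suc n. fps_nth (H ^ k) n)"
      by (simp only: sum.shift_bounds_cl_Suc_ivl)
    finally have "fps_nth (H + H * A) n = (\<Sum>k=1..Suc n. fps_nth (H ^ k) n)"
      by (subst sum.atLeast_Suc_atMost) simp_all
    with A_nth'[of n "Suc n"] show "fps_nth A n = fps_nth (H + H * A) n" by simp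
  qed
  have H_ge: "fps_nth H n \<ge> 0" for n using r by (simp add: H_nth)
  have "fps_nth (H ^ k) n \<ge> 0" for k n
    by (induction k arbitrary: n) (auto simp: fps_mult_nth H_ge intro!: sum_nonneg)
  then have A_ge: "fps_nth A n \<ge> 0" for n
    unfolding A_nth by (intro sum_nonneg) auto

  have "\<exists>t. 0 < t \<and> t < l \<and> t \<le> l * (exp t - 1)"
  proof -
    have "((\<lambda>t. l * (exp t - 1) - t) \<longlongrightarrow> l * (exp l - 1) - l) (at_left l)"
      by (intro tendsto_intros)
    moreover have "exp l > 2" using l by (metis exp_less_cancel_iff exp_ln zero_less_numeral)
    then have "l * (exp l - 1) - l > 0" using l0 by (simp add: algebra_simps)
    ultimately have "\<forall>\<^sub>F t in at_left l. l * (exp t - 1) - t > 0" by (rule order_tendstoD(1))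
    moreover have "\<forall>\<^sub>F t in at_left l. t \<in> {0<..<l}"
      using l0 by (rule eventually_at_left_real)
    ultimately have "\<forall>\<^sub>F t in at_left l. 0 < t \<and> t < l \<and> t \<le> l * (exp t - 1)"
      by eventually_elim auto
    then show ?thesis
      using eventually_happens[of _ "at_left l"] trivial_limit_at_left_real by blast
  qed
  then obtain t where t: "0 < t" "t < l" "t \<le> l * (exp t - 1)" by blast

  define c where "c n = fps_nth A n / real n" for n
  have "summable (\<lambda>i. c (Suc i) * (- l) ^ Suc i)"
    using S by (rule back_subst) (auto simp: c_def A_def Let_def field_simps)
  then have Sl: "summable (\<lambda>i. c i * (- l) ^ i)" by (subst (asm) summable_Suc_iff)
  have "summable (\<lambda>n. diffs c n * t ^ n)"
  proof (rule termdiff_converges)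
    show "norm t < l" using t by simp
    show "summable (\<lambda>n. c n * x ^ n)" if "norm x < l" for x :: real
      by (rule powser_inside[OF Sl]) (use that l0 in simp)
  qed
  moreover have "diffs c n = fps_nth A (Suc n)" for n
    by (simp add: diffs_def c_def)
  ultimately have "summable (\<lambda>n. t * (fps_nth A (Suc n) * t ^ n))" by (intro summable_mult) simp
  then have "summable (\<lambda>n. fps_nth A (Suc n) * t ^ Suc n)" by (simp add: mult_ac)
  then have SA: "summable (\<lambda>n. fps_nth A n * t ^ n)" by (subst (asm) summable_Suc_iff)

  have "(\<lambda>n. t ^ n / fact n) sums exp t"
    using exp_converges[of t] by (simp add: divide_inverse mult.commute)
  then have "(\<lambda>n. t ^ Suc n / fact (Suc n)) sums (exp t - 1)"
    by (subst sums_Suc_iff) simp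
  then have "(\<lambda>n. t ^ Suc (Suc n) / fact (Suc (Suc n))) sums (exp t - 1 - t)"
    by (subst sums_Suc_iff[where f = "\<lambda>n. t ^ Suc n / fact (Suc n)"]) simp
  then have "(\<lambda>n. r / t * (t ^ Suc (Suc n) / fact (Suc (Suc n)))) sums (r / t * (exp t - 1 - t))"
    by (rule sums_mult)
  moreover have "r / t * (t ^ Suc (Suc n) / fact (Suc (Suc n))) = fps_nth H (Suc n) * t ^ Suc n" for n
    using t by (simp add: H_nth)
  ultimately have "(\<lambda>n. fps_nth H (Suc n) * t ^ Suc n) sums (r / t * (exp t - 1 - t))" by simp
  then have H_sums: "(\<lambda>n. fps_nth H n * t ^ n) sums (r / t * (exp t - 1 - t))"
    by (subst (asm) sums_Suc_iff) (simp add: H_nth)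
  define h where "h = r / t * (exp t - 1 - t)"
  have h1: "h \<ge> 1" using t l l0 unfolding h_def r_def by (simp add: field_simps)
  define a where "a = (\<Sum>n. fps_nth A n * t ^ n)"
  have A_sums: "(\<lambda>n. fps_nth A n * t ^ n) sums a" unfolding a_def using SA by (rule summable_sums)
  have a0: "a \<ge> 0" unfolding a_def using SA A_ge t by (intro suminf_nonneg) auto
  have nH: "summable (\<lambda>n. norm (fps_nth H n * t ^ n))"
    using sums_summable[OF H_sums] H_ge t by (simp add: abs_mult)
  have nA: "summable (\<lambda>n. norm (fps_nth A n * t ^ n))"
    using SA A_ge t by (simp add: abs_mult)
  have "(\<lambda>n. \<Sum>i\<le>n. (fps_nth H i * t ^ i) * (fps_nth A (n - i) * t ^ (n - i))) sums (h * a)"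
    using Cauchy_product_sums[OF nH nA] sums_unique[OF H_sums] sums_unique[OF A_sums]
    by (simp add: h_def)
  moreover have "(\<Sum>i\<le>n. (fps_nth H i * t ^ i) * (fps_nth A (n - i) * t ^ (n - i)))
      = fps_nth (H * A) n * t ^ n" for n
    unfolding fps_mult_nth sum_distrib_right atLeast0AtMost
  proof (rule sum.cong)
    show "(fps_nth H i * t ^ i) * (fps_nth A (n - i) * t ^ (n - i)) = fps_nth H i * fps_nth A (n - i) * t ^ n"
      if "i \<in> {..n}" for i
      using that power_add[of t i "n - i"] by simp
  qed simp
  ultimately have "(\<lambda>n. fps_nth (H * A) n * t ^ n) sums (h * a)" by simp
  from sums_add[OF H_sums[folded h_def] this]
  have "(\<lambda>n. fps_nth A n * t ^ n) sums (h + h * a)"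
    by (subst A_eq) (simp add: distrib_right)
  with A_sums have "a = h + h * a" by (rule sums_unique2)
  moreover have "h * a \<ge> a" using h1 a0 by (simp add: mult_le_cancel_right1)
  ultimately show False using h1 by linarith
qed

end

(* Write y = s - 1. The numbers u_n = b_n / n! form a renewal sequence, u = p + p * u (convolution),
   where p_n are the nonnegative Taylor coefficients of g at 1. Hence the series of u has sum g / (1 - g)
   as long as g (1 + |y|) < 1, and integrating it termwise, divided by y, expands G around 1.
   For l < ln 2 one has g 2 < 1, so the expansion reaches s = 0, where G vanishes. For l = ln 2 the
   p_n sum to 1 and decay fast enough that u_n converges geometrically to a constant c; then the series
   of G is - c ln (1 - y) plus a power series of radius greater than 1, which settles y = -1. *)

theory Submission
  imports Defs
begin

section \<open>The renewal sequence and its recursion\<close>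

text \<open>Taylor coefficients of \<open>g_fun l\<close> at 1. Index 0 is separate because g(1) =
  0, where the formula would give \<open>l / (1 - l)\<close>.\<close>

definition renewal_step :: "real \<Rightarrow> nat \<Rightarrow> real" where
  "renewal_step l n = (if n = 0 then 0 else l / (1 - l) * l ^ n / fact (Suc n))"

definition renewal :: "real \<Rightarrow> nat \<Rightarrow> real" where
  "renewal l n = b_coeff l n / fact n"

lemma renewal_0 [simp]: "renewal l 0 = 0"
  by (simp add: renewal_def b_coeff_def bell_sum_def)

lemma renewal_step_0 [simp]: "renewal_step l 0 = 0"
  by (simp add: renewal_step_def)

lemma renewal_step_nonneg: "0 < l \<Longrightarrow> l < 1 \<Longrightarrow> renewal_step l n \<ge> 0"
  by (simp add: renewal_step_def)

text \<open>Up to the factor \<open>l ^ n\<close>, the generating function is \<open>S oo H\<close>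
  with S = X / (1 - X). Composing S = X + X * S with \<open>H\<close> gives the recursion, and
  \<open>l ^ n\<close> splits over the convolution.\<close>

lemma renewal_eq: "renewal l n = renewal_step l n + (\<Sum>i\<le>n. renewal_step l i * renewal l (n - i))"
proof -
  define r where "r = l / (1 - l)"
  define F :: "real fps" where "F = Abs_fps (\<lambda>m. if m = 0 then 0 else g_seq m / fact m)"
  define H where "H = fps_const r * F"
  define S :: "real fps" where "S = Abs_fps (\<lambda>k. if k = 0 then 0 else 1)"
  have H_nth: "fps_nth H m = (if m = 0 then 0 else r / fact (Suc m))" for m
    by (simp add: H_def F_def g_seq_def field_simps)
  have H0: "fps_nth H 0 = 0" by (simp add: H_nth)
  have comp_nth: "fps_nth (S oo H) n = bell_sum l n / fact n" for n
  proof -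
    have "fps_nth (S oo H) n = (\<Sum>k=1..n. fps_nth (H ^ k) n)"
      unfolding fps_compose_nth
      by (intro sum.mono_neutral_cong_right) (auto simp: S_def)
    \<comment> \<open>\<open>fact k\<close> cancels the \<open>1 / fact k\<close> inside
      \<open>bell_poly\<close>, and \<open>r ^ k\<close> is absorbed into
      \<open>H ^ k\<close>.\<close>
    also have "\<dots> = bell_sum l n / fact n"
      by (simp add: bell_sum_def bell_poly_def H_def power_mult_distrib fps_const_power
        F_def[symmetric] r_def[symmetric] sum_divide_distrib)
    finally show ?thesis .
  qed
  have "S = fps_X + fps_X * S"
    by (rule fps_ext) (auto simp: S_def)
  then have "S oo H = (fps_X + fps_X * S) oo H" by simp
  also have "\<dots> = H + H * (S oo H)"
    by (simp add: fps_compose_add_distrib fps_compose_mult_distrib H0)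
  finally have "fps_nth (S oo H) n = fps_nth (H + H * (S oo H)) n" by simp
  then have "l ^ n * (bell_sum l n / fact n) =
      l ^ n * fps_nth H n + (\<Sum>i\<le>n. l ^ n * (fps_nth H i * (bell_sum l (n - i) / fact (n - i))))"
    by (simp add: fps_mult_nth comp_nth atLeast0AtMost distrib_left sum_distrib_left)
  also have "(\<Sum>i\<le>n. l ^ n * (fps_nth H i * (bell_sum l (n - i) / fact (n - i)))) =
      (\<Sum>i\<le>n. renewal_step l i * renewal l (n - i))"
  proof (rule sum.cong)
    fix i assume "i \<in> {..n}"
    then have "l ^ n = l ^ i * l ^ (n - i)" by (simp flip: power_add)
    then show "l ^ n * (fps_nth H i * (bell_sum l (n - i) / fact (n - i))) =
        renewal_step l i * renewal l (n - i)"
      by (simp add: H_nth renewal_step_def renewal_def b_coeff_def r_def)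
  qed simp
  also have "l ^ n * fps_nth H n = renewal_step l n"
    by (simp add: H_nth renewal_step_def r_def)
  finally show ?thesis by (simp add: renewal_def b_coeff_def)
qed

lemma renewal_nonneg:
  assumes "0 < l" "l < 1"
  shows "renewal l n \<ge> 0"
proof (induction n rule: less_induct)
  case (less n)
  have "renewal_step l i * renewal l (n - i) \<ge> 0" if "i \<le> n" for i
  \<comment> \<open>The summand \<open>i = 0\<close> contains \<open>renewal l n\<close> itself, out
    of reach of the induction hypothesis; the factor \<open>renewal_step l 0 = 0\<close> removes
    it.\<close>
  proof (cases "i = 0 \<or> n = 0")
    case False
    then have "renewal l (n - i) \<ge> 0" by (intro less.IH) simp
    then show ?thesis using renewal_step_nonneg[OF assms] by simp
  qed (use that in auto)
  then show ?case
    unfolding renewal_eq[of l n] using renewal_step_nonneg[OF assms]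
    by (intro add_nonneg_nonneg sum_nonneg) auto
qed

section \<open>Power series of g and of g / (1 - g)\<close>

text \<open>This is the exponential series at \<open>l * y\<close> without its first two terms,
  divided by \<open>(1 - l) * y\<close>.\<close>

lemma renewal_step_sums:
  fixes l y :: real
  assumes "0 < l" "l < 1"
  shows "(\<lambda>n. renewal_step l n * y ^ n) sums g_fun l (1 + y)"
proof (cases "y = 0")
  case True
  have "(\<lambda>n. renewal_step l n * y ^ n) = (\<lambda>_. 0)"
    using True by (auto simp: fun_eq_iff power_0_left)
  then show ?thesis using True by (simp add: g_fun_def)
next
  case False
  let ?t = "l * y"
  have "(\<lambda>n. ?t ^ n / fact n) sums exp ?t"
    using exp_converges[of ?t] by (simp add: divide_inverse mult.commute)
  then have "(\<lambda>n. ?t ^ Suc n / fact (Suc n)) sums (exp ?t - 1)"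
    by (subst sums_Suc_iff) simp
  then have "(\<lambda>n. ?t ^ Suc (Suc n) / fact (Suc (Suc n))) sums (exp ?t - 1 - ?t)"
    by (subst sums_Suc_iff[where f = "\<lambda>n. ?t ^ Suc n / fact (Suc n)"]) simp
  then have "(\<lambda>n. 1 / ((1 - l) * y) * (?t ^ Suc (Suc n) / fact (Suc (Suc n))))
      sums (1 / ((1 - l) * y) * (exp ?t - 1 - ?t))"
    by (rule sums_mult)
  moreover have "1 / ((1 - l) * y) * (?t ^ Suc (Suc n) / fact (Suc (Suc n)))
      = renewal_step l (Suc n) * y ^ Suc n" for n
    using False assms by (simp add: renewal_step_def power_mult_distrib del: fact_Suc)
  ultimately have "(\<lambda>n. renewal_step l (Suc n) * y ^ Suc n) sums g_fun l (1 + y)"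
    using False by (simp add: g_fun_def)
  then show ?thesis by (subst (asm) sums_Suc_iff) simp
qed

text \<open>Provides room beyond \<open>\<rho>\<close>: from 0 it yields a neighbourhood of s = 1,
  from 1 a disc reaching past s = 0.\<close>

lemma g_fun_less_1_extend:
  fixes l \<rho> :: real
  assumes l: "0 < l" "l < 1" and "g_fun l (1 + \<rho>) < 1"
  obtains \<delta> where "\<rho> < \<delta>" "g_fun l (1 + \<delta>) < 1"
proof -
  \<comment> \<open>Continuity is read off the power series, since the quotient formula breaks down
    at \<open>\<rho> = 0\<close>.\<close>
  have "isCont (\<lambda>y. \<Sum>n. renewal_step l n * y ^ n) \<rho>"
    by (rule isCont_powser_converges_everywhere) (use renewal_step_sums[OF l] sums_summable in blast)
  then have "isCont (\<lambda>y. g_fun l (1 + y)) \<rho>"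
    using sums_unique[OF renewal_step_sums[OF l]] by simp
  then have "((\<lambda>y. g_fun l (1 + y)) \<longlongrightarrow> g_fun l (1 + \<rho>)) (at_right \<rho>)"
    unfolding isCont_def by (rule filterlim_mono) (auto simp: at_le)
  then have "\<forall>\<^sub>F y in at_right \<rho>. g_fun l (1 + y) < 1"
    using assms(3) by (rule order_tendstoD)
  moreover have "\<forall>\<^sub>F y in at_right \<rho>. \<rho> < y" by (rule eventually_at_right_less)
  ultimately have "\<forall>\<^sub>F y in at_right \<rho>. \<rho> < y \<and> g_fun l (1 + y) < 1" by eventually_elim simp
  then show thesis
    using that eventually_happens[of _ "at_right \<rho>"] trivial_limit_at_right_real by blast
qed

text \<open>All terms being nonnegative, enlarging the triangle i + j <= N to a square gives U <= g
  + g * U for each partial sum U, which is a bound since g < 1.\<close>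

lemma summable_renewal:
  fixes l y :: real
  assumes l: "0 < l" "l < 1" and y: "0 \<le> y" and g: "g_fun l (1 + y) < 1"
  shows "summable (\<lambda>n. renewal l n * y ^ n)"
proof -
  let ?p = "\<lambda>n. renewal_step l n * y ^ n" and ?u = "\<lambda>n. renewal l n * y ^ n"
  let ?g = "g_fun l (1 + y)"
  have p0: "?p n \<ge> 0" and u0: "?u n \<ge> 0" for n
    using renewal_step_nonneg[OF l] renewal_nonneg[OF l] y by auto
  have p_le: "sum ?p A \<le> ?g" if "finite A" for A
    using sum_le_suminf[OF sums_summable[OF renewal_step_sums[OF l]] that] p0
      sums_unique[OF renewal_step_sums[OF l]] by simp
  have "sum ?u {..N} \<le> ?g / (1 - ?g)" for N
  proof -
    have u_eq: "?u n = ?p n + (\<Sum>i\<le>n. ?p i * ?u (n - i))" for n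
    proof -
      have "?u n = ?p n + (\<Sum>i\<le>n. renewal_step l i * renewal l (n - i) * y ^ n)"
        by (subst renewal_eq) (simp add: distrib_right sum_distrib_right)
      also have "(\<Sum>i\<le>n. renewal_step l i * renewal l (n - i) * y ^ n) = (\<Sum>i\<le>n. ?p i * ?u (n - i))"
      proof (rule sum.cong)
        fix i assume "i \<in> {..n}"
        then have "y ^ n = y ^ i * y ^ (n - i)" by (simp flip: power_add)
        then show "renewal_step l i * renewal l (n - i) * y ^ n = ?p i * ?u (n - i)" by simp
      qed simp
      finally show ?thesis .
    qed
    have "sum ?u {..N} = sum ?p {..N} + (\<Sum>n\<le>N. \<Sum>i\<le>n. ?p i * ?u (n - i))"
      by (subst u_eq) (simp add: sum.distrib)
    also have "(\<Sum>n\<le>N. \<Sum>i\<le>n. ?p i * ?u (n - i)) = (\<Sum>(i, j)\<in>{(i, j). i + j \<le> N}. ?p i * ?u j)"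
      by (rule sum.triangle_reindex_eq[symmetric])
    also have "\<dots> \<le> (\<Sum>(i, j)\<in>{..N} \<times> {..N}. ?p i * ?u j)"
      by (intro sum_mono2) (auto intro: mult_nonneg_nonneg[OF p0 u0])
    also have "\<dots> = sum ?p {..N} * sum ?u {..N}" by (simp add: sum_product sum.cartesian_product)
    also have "sum ?p {..N} + sum ?p {..N} * sum ?u {..N} \<le> ?g + ?g * sum ?u {..N}"
      by (intro add_mono mult_right_mono p_le sum_nonneg u0) auto
    finally show ?thesis using g by (simp add: field_simps)
  qed
  then show ?thesis
    using u0 by (intro bounded_imp_summable) auto
qed

text \<open>The recursion is a Cauchy product of absolutely convergent series. The identity is left
  multiplied out because g(1 + y) being different from 1 is later deduced from it.\<close>

lemma renewal_suminf:
  fixes l y \<delta> :: real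
  assumes l: "0 < l" "l < 1" and g: "g_fun l (1 + \<delta>) < 1" and y: "\<bar>y\<bar> \<le> \<delta>"
  shows "(\<Sum>n. renewal l n * y ^ n) * (1 - g_fun l (1 + y)) = g_fun l (1 + y)"
proof -
  let ?p = "\<lambda>n. renewal_step l n * y ^ n" and ?u = "\<lambda>n. renewal l n * y ^ n"
  let ?g = "g_fun l (1 + y)" and ?a = "\<Sum>n. renewal l n * y ^ n"
  have np: "summable (\<lambda>n. norm (?p n))"
    using sums_summable[OF renewal_step_sums[OF l, of "\<bar>y\<bar>"]] renewal_step_nonneg[OF l]
    by (simp add: abs_mult power_abs)
  have nu: "summable (\<lambda>n. norm (?u n))"
    by (rule summable_comparison_test'[OF summable_renewal[OF l _ g], of 0])
      (use y renewal_nonneg[OF l] in \<open>auto simp: abs_mult power_abs intro!: mult_left_mono power_mono\<close>)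
  have "(\<lambda>n. \<Sum>i\<le>n. ?p i * ?u (n - i)) sums (?g * ?a)"
    using Cauchy_product_sums[OF np nu] sums_unique[OF renewal_step_sums[OF l]] by simp
  moreover have "(\<Sum>i\<le>n. ?p i * ?u (n - i)) = (renewal l n - renewal_step l n) * y ^ n" for n
  proof -
    have "(renewal l n - renewal_step l n) * y ^ n =
        (\<Sum>i\<le>n. renewal_step l i * renewal l (n - i) * y ^ n)"
      by (subst renewal_eq) (simp add: sum_distrib_right)
    also have "\<dots> = (\<Sum>i\<le>n. ?p i * ?u (n - i))"
    proof (rule sum.cong)
      fix i assume "i \<in> {..n}"
      then have "y ^ n = y ^ i * y ^ (n - i)" by (simp flip: power_add)
      then show "renewal_step l i * renewal l (n - i) * y ^ n = ?p i * ?u (n - i)" by simp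
    qed simp
    finally show ?thesis by simp
  qed
  moreover have "(\<lambda>n. (renewal l n - renewal_step l n) * y ^ n) sums (?a - ?g)"
    using sums_diff[OF summable_sums[OF summable_norm_cancel[OF nu]] renewal_step_sums[OF l, of y]]
    by (simp add: left_diff_distrib)
  ultimately have "?g * ?a = ?a - ?g"
    using sums_unique2 by simp
  then show ?thesis by (simp add: algebra_simps)
qed

section \<open>The power series antiderivative\<close>

text \<open>Termwise integral of the renewal series divided by \<open>y\<close>; the term
  \<open>n = 0\<close> is \<open>0 / 0 = 0\<close>.\<close>

definition G_series :: "real \<Rightarrow> real \<Rightarrow> real" where
  "G_series l y = (\<Sum>n. renewal l n / real n * y ^ n)"

lemma summable_G_series:
  fixes l y \<delta> :: real
  assumes l: "0 < l" "l < 1" and g: "g_fun l (1 + \<delta>) < 1" and y: "\<bar>y\<bar> \<le> \<delta>"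
  shows "summable (\<lambda>n. renewal l n / real n * y ^ n)"
proof (rule summable_comparison_test'[OF summable_renewal[OF l _ g], of 0])
  show "norm (renewal l n / real n * y ^ n) \<le> renewal l n * \<delta> ^ n" for n
  proof -
    have "renewal l n / real n \<le> renewal l n"
      using renewal_nonneg[OF l, of n] mult_right_mono[of 1 "real n" "renewal l n"]
      by (cases "n = 0") (auto simp: divide_le_eq mult.commute)
    then show ?thesis
      unfolding norm_mult norm_power using renewal_nonneg[OF l, of n] y
      by (intro mult_mono power_mono) auto
  qed
qed (use y in auto)

text \<open>\<open>y\<close> times the termwise derivative is the renewal series, that is g / (1 -
  g) = 1 / (1 - g) - 1. At \<open>y = 0\<close> the right-hand formula has the default value 0,
  which is not the derivative, but differentiability there still gives continuity.\<close>

lemma DERIV_G_series: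
  fixes l y \<delta> :: real
  assumes l: "0 < l" "l < 1" and g: "g_fun l (1 + \<delta>) < 1" and y: "\<bar>y\<bar> < \<delta>"
  shows "\<exists>D. DERIV (G_series l) y :> D \<and> (y \<noteq> 0 \<longrightarrow> D = 1 / y * (1 / (1 - g_fun l (1 + y)) - 1))"
proof -
  let ?a = "\<Sum>n. renewal l n * y ^ n" and ?D = "\<Sum>n. renewal l (Suc n) * y ^ n"
  have D: "DERIV (G_series l) y :> ?D"
    using termdiffs_strong[OF summable_G_series[OF l g], of \<delta> y] y
    unfolding G_series_def diffs_def by simp
  have su: "summable (\<lambda>n. renewal l n * y ^ n)"
    by (rule powser_inside[OF summable_renewal[OF l _ g]]) (use y in auto)
  moreover have "?D = 1 / y * (1 / (1 - g_fun l (1 + y)) - 1)" if "y \<noteq> 0"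
  proof -
    have *: "?a * (1 - g_fun l (1 + y)) = g_fun l (1 + y)"
      by (rule renewal_suminf[OF l g]) (use y in simp)
    \<comment> \<open>If \<open>g_fun l (1 + y)\<close> were 1, \<open>*\<close> would read 0 =
      1.\<close>
    then have "1 - g_fun l (1 + y) \<noteq> 0" by auto
    with * have "?a = 1 / (1 - g_fun l (1 + y)) - 1" by (simp add: field_simps)
    moreover have "?a = y * ?D"
    proof -
      have "?a = (\<Sum>n. renewal l (Suc n) * y ^ Suc n)"
        using suminf_split_head[OF su] by simp
      also have "\<dots> = (\<Sum>n. y * (renewal l (Suc n) * y ^ n))" by (simp add: mult_ac)
      also have "\<dots> = y * ?D"
        using that su
        by (intro suminf_mult) (simp add: summable_powser_split_head[of "\<lambda>n. renewal l n"])
      finally show ?thesis .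
    qed
    ultimately show ?thesis using that by (simp add: nonzero_eq_divide_eq mult.commute)
  qed
  ultimately show ?thesis using D by blast
qed

abbreviation G_integrand :: "real \<Rightarrow> real \<Rightarrow> real" where
  "G_integrand l \<equiv> \<lambda>x. 1 / (x - 1) * (1 / (1 - g_fun l x) - 1)"

text \<open>The interval may contain 1, where the integrand has a default value; the fundamental
  theorem allows this exceptional point since the antiderivative is continuous across it.\<close>

lemma has_integral_G_integrand:
  fixes l a b \<delta> :: real
  assumes l: "0 < l" "l < 1" and g: "g_fun l (1 + \<delta>) < 1"
    and ab: "a \<le> b" "1 - \<delta> < a" "b < 1 + \<delta>"
  shows "(G_integrand l has_integral (G_series l (b - 1) - G_series l (a - 1))) {a..b}"
proof (rule fundamental_theorem_of_calculus_strong[where S = "{1}"])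
  have D: "\<exists>D. DERIV (\<lambda>x. G_series l (x - 1)) x :> D \<and> (x \<noteq> 1 \<longrightarrow> D = G_integrand l x)"
    if "x \<in> {a..b}" for x
  proof -
    from that ab have "\<bar>x - 1\<bar> < \<delta>" by auto
    from DERIV_G_series[OF l g this] obtain D where D: "DERIV (G_series l) (x - 1) :> D"
      "x \<noteq> 1 \<longrightarrow> D = G_integrand l x" by auto
    have "DERIV (\<lambda>x. G_series l (x - 1)) x :> D"
      using DERIV_chain2[of "G_series l" D "\<lambda>x. x - 1" x 1 UNIV] D(1)
      by (simp add: DERIV_diff[OF DERIV_ident DERIV_const, simplified])
    with D show ?thesis by blast
  qed
  show "((\<lambda>x. G_series l (x - 1)) has_vector_derivative G_integrand l x) (at x)"
    if "x \<in> {a..b} - {1}" for x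
    using D[of x] that by (auto simp: has_real_derivative_iff_has_vector_derivative)
  show "continuous_on {a..b} (\<lambda>x. G_series l (x - 1))"
    using D by (intro continuous_at_imp_continuous_on) (blast intro: DERIV_isCont)
qed (use ab in auto)

section \<open>Sign of the integrand and integration from 0\<close>

lemma g_fun_neg:
  fixes l x :: real
  assumes "0 < l" "l < 1" "x < 1"
  shows "g_fun l x < 0"
proof -
  have "exp (l * (x - 1)) > 1 + l * (x - 1)"
    \<comment> \<open>Equality would give ln z = z - 1 for z = \<open>exp (l * (x - 1))\<close>,
      hence z = 1 and \<open>x = 1\<close>.\<close>
    using assms exp_ge_add_one_self[of "l * (x - 1)"] ln_eq_minus_one[of "exp (l * (x - 1))"]
    by (auto simp: less_le)
  then show ?thesis using assms by (simp add: g_fun_def divide_pos_neg mult_pos_neg)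
qed

lemma G_integrand_pos:
  fixes l x :: real
  assumes "0 < l" "l < 1" "x < 1"
  shows "G_integrand l x > 0"
  using g_fun_neg[OF assms] assms by (intro mult_neg_neg) (auto simp: field_simps)

lemma continuous_on_G_integrand:
  fixes l a :: real
  assumes "0 < l" "l < 1" "a < 1"
  shows "continuous_on {0..a} (G_integrand l)"
proof -
  have "continuous_on {0..a} (g_fun l)"
  proof (rule continuous_on_eq)
    show "continuous_on {0..a} (\<lambda>x. (exp (l * (x - 1)) - 1 - l * (x - 1)) / ((1 - l) * (x - 1)))"
      by (intro continuous_intros) (use assms in auto)
  qed (use assms in \<open>auto simp: g_fun_def\<close>)
  moreover have "1 - g_fun l x \<noteq> 0" if "x \<in> {0..a}" for x
    using g_fun_neg[OF assms(1,2), of x] that assms(3) by auto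
  ultimately show ?thesis
    by (intro continuous_intros) (use assms in auto)
qed

lemma G_fun_0 [simp]: "G_fun l 0 = 0"
  by (simp add: G_fun_def)

text \<open>The integrals start at 0, possibly outside the disc around 1. Both are split at a common
  point \<open>a\<close>, and the piece over \<open>{0..a}\<close> cancels. The bound
  \<open>-1 \<le> y\<close> keeps the upper limit nonnegative.\<close>

lemma G_fun_expansion:
  fixes l y \<delta> :: real
  assumes l: "0 < l" "l < 1" and g: "g_fun l (1 + \<delta>) < 1" and y: "\<bar>y\<bar> < \<delta>" "-1 \<le> y"
  shows "G_fun l (1 + y) - G_fun l 1 = G_series l y"
proof -
  \<comment> \<open>\<open>a\<close> must be nonnegative, below 1, at most \<open>1 + y\<close> and
    above \<open>1 - \<delta>\<close>.\<close>
  define a where "a = (if y < 0 then 1 + y else max 0 (1 - \<delta> / 2))"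
  have a: "0 \<le> a" "a < 1" "1 - \<delta> < a" "a \<le> 1 + y" using y by (auto simp: a_def)
  have "G_integrand l integrable_on {0..a}"
    by (intro integrable_continuous_real continuous_on_G_integrand l a)
  then have I: "(G_integrand l has_integral G_fun l a) {0..a}"
    unfolding G_fun_def by (rule integrable_integral)
  have *: "G_fun l b = G_fun l a + (G_series l (b - 1) - G_series l (a - 1))"
    if "a \<le> b" "b < 1 + \<delta>" for b
    unfolding G_fun_def[of l b]
    by (intro integral_unique has_integral_combine[OF a(1) _ I]
          has_integral_G_integrand[OF l g] that a)
  have "G_series l 0 = 0"
    unfolding G_series_def by (subst suminf_cong[where g = "\<lambda>_. 0"]) (auto simp: power_0_left)
  then show ?thesis using *[of 1] *[of "1 + y"] a y by simp
qed

text \<open>The integrand is positive left of 1. Continuity makes the integral over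
  \<open>{0..a}\<close> strictly positive; the rest, with the discontinuity at 1, contributes at
  least 0.\<close>

lemma G_fun_pos:
  fixes l :: real
  assumes l: "0 < l" "l < 1"
  shows "G_fun l 1 > 0"
proof -
  obtain \<delta> where \<delta>: "0 < \<delta>" "g_fun l (1 + \<delta>) < 1"
    by (rule g_fun_less_1_extend[OF l, of 0]) (auto simp: g_fun_def)
  define a where "a = max (1 / 2) (1 - \<delta> / 2)"
  have a: "0 < a" "a < 1" "1 - \<delta> < a" using \<delta> by (auto simp: a_def)
  have J: "G_integrand l integrable_on {0..a}"
    by (intro integrable_continuous_real continuous_on_G_integrand l a)
  have "integral {0..a} (\<lambda>_. 0) < integral {0..a} (G_integrand l)"
    by (intro integral_less_real continuous_on_G_integrand l a G_integrand_pos continuous_on_const)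
      (use a in auto)
  then have A: "G_fun l a > 0" by (simp add: G_fun_def)
  have K: "(G_integrand l has_integral (G_series l (1 - 1) - G_series l (a - 1))) {a..1}"
    by (rule has_integral_G_integrand[OF l \<delta>(2)]) (use a \<delta> in auto)
  have "G_series l (1 - 1) - G_series l (a - 1) \<ge> 0"
  proof (rule has_integral_nonneg[OF K])
    show "G_integrand l x \<ge> 0" if "x \<in> {a..1}" for x
      using G_integrand_pos[OF l, of x] that by (cases "x = 1") auto
  qed
  moreover have "G_fun l 1 = G_fun l a + (G_series l (1 - 1) - G_series l (a - 1))"
    unfolding G_fun_def
    by (intro integral_unique has_integral_combine[OF _ _ integrable_integral[OF J] K]) (use a in auto)
  ultimately show ?thesis using A by simp
qed

section \<open>The boundary case l = ln 2\<close>

text \<open>Here the steps sum to 1, so 1 - P factors as (1 - X) * Q, with Q the series of tails.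
  For V = 1 / (1 - P) the differences D = (1 - X) * V = 1 / Q decay geometrically, so the
  coefficients of V approach the sum \<open>c\<close> of those of D at the same rate.\<close>

lemma renewal_ln_2_geometric:
  "\<exists>c. \<forall>n>0. \<bar>renewal (ln 2) n - c\<bar> \<le> (1 / 2) ^ n"
proof -
  define l :: real where "l = ln 2"
  have l: "0 < l" "l < 1" and l34: "l \<le> 3 / 4"
    using ln2_le_25_over_36 by (auto simp: l_def)
  have "g_fun l (1 + 1) = 1"
    using l by (simp add: g_fun_def l_def)
  with renewal_step_sums[OF l, of 1] have p_sums: "renewal_step l sums 1" by simp
  define q where "q k = 1 - (\<Sum>i\<le>k. renewal_step l i)" for k
  have sp: "summable (\<lambda>i. renewal_step l (i + k))" for k
    using sums_summable[OF p_sums] by (simp add: summable_iff_shift)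
  have q_tail: "q k = (\<Sum>i. renewal_step l (i + Suc k))" for k
    using suminf_split_initial_segment[OF sums_summable[OF p_sums], of "Suc k"] sums_unique[OF p_sums]
    by (simp add: q_def lessThan_Suc_atMost)
  have q0: "q k \<ge> 0" for k
    unfolding q_tail by (intro suminf_nonneg sp renewal_step_nonneg l)
  have q_le: "q k \<le> (1 / 4) ^ k" for k
  proof (induction k)
    case 0
    then show ?case by (simp add: q_def)
  next
    case (Suc k)
    \<comment> \<open>The ratio is \<open>l / (n + 3)\<close>, at most 1/4 because
      \<open>l \<le> 3 / 4\<close>.\<close>
    have step: "renewal_step l (Suc (Suc n)) \<le> renewal_step l (Suc n) / 4" for n
    proof -
      have "renewal_step l (Suc (Suc n)) = renewal_step l (Suc n) * (l / (real n + 3))"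
        by (simp add: renewal_step_def field_simps)
      also have "\<dots> \<le> renewal_step l (Suc n) * (1 / 4)"
        using l34 by (intro mult_left_mono renewal_step_nonneg l) (simp add: field_simps)
      finally show ?thesis by simp
    qed
    have "q (Suc k) \<le> (\<Sum>i. renewal_step l (i + Suc k) / 4)"
      unfolding q_tail using step by (intro suminf_le sp summable_divide) auto
    also have "\<dots> = q k / 4"
      unfolding q_tail by (rule suminf_divide[OF sp])
    finally show ?case using Suc by simp
  qed
  \<comment> \<open>The added 1 turns the recursion into \<open>V * (1 - P) = 1\<close>. It affects
    only index 0, hence \<open>n > 0\<close> in the claim.\<close>
  define V where "V = 1 + Abs_fps (renewal l)"
  define P where "P = Abs_fps (renewal_step l)"
  define D where "D = (1 - fps_X) * V"
  have "V - 1 = P + P * (V - 1)"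
  proof (rule fps_ext)
    show "fps_nth (V - 1) n = fps_nth (P + P * (V - 1)) n" for n
      using renewal_eq[of l n] by (simp add: V_def P_def fps_mult_nth atLeast0AtMost)
  qed
  then have V: "V * (1 - P) = 1" by (simp add: algebra_simps)
  have Q: "(1 - fps_X) * Abs_fps q = 1 - P"
  proof (rule fps_ext)
    show "fps_nth ((1 - fps_X) * Abs_fps q) n = fps_nth (1 - P) n" for n
      by (cases n) (simp_all add: left_diff_distrib P_def q_def)
  qed
  have DQ: "Abs_fps q * D = 1"
    using V Q by (simp add: D_def mult_ac)
  \<comment> \<open>As \<open>q 0 = 1\<close>, \<open>DQ\<close> expresses each coefficient through
    earlier ones. The rate 1/2 reproduces itself: (1/4)^i * (1/2)^(n-i) = (1/2)^n * (1/2)^i, and the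
    (1/2)^i with i >= 1 sum to at most 1.\<close>
  have D_le: "\<bar>fps_nth D n\<bar> \<le> (1 / 2) ^ n" for n
  proof (induction n rule: less_induct)
    case (less n)
    have "(\<Sum>i=0..n. q i * fps_nth D (n - i)) = (if n = 0 then 1 else 0)"
      using arg_cong[OF DQ, of "\<lambda>F. fps_nth F n"] by (simp add: fps_mult_nth)
    then have "fps_nth D n = (if n = 0 then 1 else 0) - (\<Sum>i=1..n. q i * fps_nth D (n - i))"
      by (subst (asm) sum.atLeast_Suc_atMost) (auto simp: q_def)
    moreover have "\<bar>\<Sum>i=1..n. q i * fps_nth D (n - i)\<bar> \<le> (\<Sum>i=1..n. (1 / 2) ^ n * (1 / 2) ^ i)"
    proof (rule order_trans[OF sum_abs sum_mono])
      fix i assume i: "i \<in> {1..n}"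
      have "\<bar>q i * fps_nth D (n - i)\<bar> \<le> (1 / 4) ^ i * (1 / 2) ^ (n - i)"
        unfolding abs_mult using i q0[of i] q_le[of i] by (intro mult_mono less.IH) auto
      also have "(1 / 4 :: real) ^ i = (1 / 2) ^ i * (1 / 2) ^ i"
        by (simp flip: power_mult_distrib)
      also have "(1 / 2) ^ i * (1 / 2) ^ i * (1 / 2 :: real) ^ (n - i) = (1 / 2) ^ n * (1 / 2) ^ i"
        using i by (simp add: add.commute flip: power_add)
      finally show "\<bar>q i * fps_nth D (n - i)\<bar> \<le> (1 / 2) ^ n * (1 / 2) ^ i" .
    qed
    moreover have "(\<Sum>i=1..n. (1 / 2 :: real) ^ i) = 1 - (1 / 2) ^ n"
      by (induction n) auto
    then have "(\<Sum>i=1..n. (1 / 2 :: real) ^ n * (1 / 2) ^ i) \<le> (1 / 2) ^ n"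
      by (simp flip: sum_distrib_left)
    ultimately show ?case by (cases "n = 0") auto
  qed
  have D_nth: "fps_nth D (Suc n) = fps_nth V (Suc n) - fps_nth V n" for n
    by (simp add: D_def left_diff_distrib)
  have V_nth: "fps_nth V n = (\<Sum>k\<le>n. fps_nth D k)" for n
    by (induction n) (simp_all add: D_nth, simp add: D_def left_diff_distrib)
  have sh: "summable (\<lambda>n. (1 / 2 :: real) ^ n)" by (simp add: summable_geometric)
  have sD: "summable (fps_nth D)"
    by (rule summable_comparison_test'[OF sh, of 0]) (use D_le in simp)
  define c where "c = suminf (fps_nth D)"
  show ?thesis
  proof (intro exI[of _ c] allI impI)
    fix n :: nat assume "n > 0"
    have half: "(\<lambda>k. (1 / 2) ^ Suc n * (1 / 2 :: real) ^ k) sums ((1 / 2) ^ Suc n * (1 / (1 - 1 / 2)))"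
      by (intro sums_mult geometric_sums) simp
    have "c - fps_nth V n = (\<Sum>k. fps_nth D (k + Suc n))"
      using suminf_split_initial_segment[OF sD, of "Suc n"]
      by (simp add: c_def V_nth lessThan_Suc_atMost)
    also have "\<bar>\<dots>\<bar> \<le> (\<Sum>k. (1 / 2) ^ Suc n * (1 / 2) ^ k)"
      unfolding real_norm_def[symmetric]
      by (rule norm_suminf_le[OF _ sums_summable[OF half]])
        (use D_le[of "_ + Suc n"] in \<open>simp add: power_add mult_ac\<close>)
    also have "\<dots> = (1 / 2) ^ n" using sums_unique[OF half] by simp
    finally show "\<bar>renewal (ln 2) n - c\<bar> \<le> (1 / 2) ^ n"
      using \<open>n > 0\<close> by (simp add: V_def l_def abs_minus_commute)
  qed
qed

text \<open>The endpoint \<open>y = -1\<close> is the alternating harmonic series. The term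
  \<open>n = 0\<close> is 0 by division by zero.\<close>

lemma Mercator_sums:
  fixes y :: real
  assumes "-1 \<le> y" "y < 1"
  shows "(\<lambda>n. y ^ n / real n) sums (- ln (1 - y))"
proof (cases "y = -1")
  case True
  have "(\<lambda>k. - ((-1) ^ k / real (Suc k))) sums (- ln 2)"
    by (rule sums_minus[OF alternating_harmonic_series_sums])
  then have "(\<lambda>k. y ^ Suc k / real (Suc k)) sums (- ln 2)" using True by simp
  then show ?thesis using True by (subst (asm) sums_Suc_iff) simp
next
  case False
  with assms show ?thesis using sums_minus[OF ln_series'[of "-y"]] by simp
qed

text \<open>Replacing the coefficients by their limit \<open>c\<close> gives
  \<open>- c * ln (1 - y)\<close>; the remainder \<open>E\<close> has radius greater than 1. Both
  are continuous at -1.\<close>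

lemma G_series_ln_2_at_minus_1:
  shows "summable (\<lambda>n. renewal (ln 2) n / real n * (-1) ^ n)"
    and "(G_series (ln 2) \<longlongrightarrow> G_series (ln 2) (-1)) (at_right (-1))"
proof -
  obtain c where c: "\<And>n. n > 0 \<Longrightarrow> \<bar>renewal (ln 2) n - c\<bar> \<le> (1 / 2) ^ n"
    using renewal_ln_2_geometric by blast
  define e where "e n = (renewal (ln 2) n - c) / real n" for n
  define E where "E y = (\<Sum>n. e n * y ^ n)" for y
  have "\<bar>e n\<bar> \<le> (1 / 2) ^ n" for n
  proof (cases "n = 0")
    case False
    then have "\<bar>e n\<bar> \<le> \<bar>renewal (ln 2) n - c\<bar>"
      by (simp add: e_def abs_divide divide_le_eq mult_le_cancel_left1)
    with c[of n] False show ?thesis by simp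
  qed (simp add: e_def)
  \<comment> \<open>3/2 is one choice between 1 and 2: beyond the unit circle, yet with ratio 3/4
    below 1.\<close>
  then have "norm (e n * (3 / 2) ^ n) \<le> (1 / 2) ^ n * (3 / 2) ^ n" for n
    by (simp add: abs_mult mult_right_mono)
  then have "norm (e n * (3 / 2) ^ n) \<le> (3 / 4) ^ n" for n
    by (simp flip: power_mult_distrib)
  then have sE: "summable (\<lambda>n. e n * (3 / 2) ^ n)"
    by (intro summable_comparison_test'[OF summable_geometric[of "3 / 4 :: real"], of 0]) auto
  have sums: "(\<lambda>n. renewal (ln 2) n / real n * y ^ n) sums (c * (- ln (1 - y)) + E y)"
    if "-1 \<le> y" "y < 1" for y
  proof -
    have "(\<lambda>n. e n * y ^ n) sums E y"
      unfolding E_def by (rule summable_sums[OF powser_inside[OF sE]]) (use that in auto)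
    from sums_add[OF sums_mult[OF Mercator_sums[OF that], of c] this]
    have "(\<lambda>n. c * (y ^ n / real n) + e n * y ^ n) sums (c * (- ln (1 - y)) + E y)" .
    moreover have "c * (Y / m) + (r - c) / m * Y = r / m * Y" for Y m r :: real
      by (simp add: diff_divide_distrib algebra_simps)
    ultimately show ?thesis by (simp only: e_def)
  qed
  then show "summable (\<lambda>n. renewal (ln 2) n / real n * (-1) ^ n)"
    using sums_summable by force
  have eq: "G_series (ln 2) y = c * (- ln (1 - y)) + E y" if "-1 \<le> y" "y < 1" for y
    using sums_unique[OF sums[OF that]] by (simp add: G_series_def)
  have "isCont E (-1)"
    unfolding E_def by (rule isCont_powser[OF sE]) simp
  then have "((\<lambda>y. c * (- ln (1 - y)) + E y) \<longlongrightarrow> c * (- ln (1 - (-1))) + E (-1)) (at_right (-1))"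
    by (intro tendsto_intros) (auto simp: isCont_def intro: filterlim_mono at_le)
  moreover have "\<forall>\<^sub>F y in at_right (-1). c * (- ln (1 - y)) + E y = G_series (ln 2) y"
    using eventually_at_right_real[of "-1" "0::real"] by (auto elim!: eventually_mono simp: eq)
  ultimately show "(G_series (ln 2) \<longlongrightarrow> G_series (ln 2) (-1)) (at_right (-1))"
    using eq[of "-1"] by (simp add: tendsto_cong)
qed

section \<open>The expansion at s = 0\<close>

text \<open>\<open>y = -1\<close> is s = 0, where G vanishes. Below ln 2 the disc reaches past -1;
  at ln 2 the expansion is used for -1 < y < 0 and both sides are compared as y tends to -1.\<close>

lemma G_series_sums_at_minus_1:
  fixes l :: real
  assumes l: "0 < l" "l < 1" and "l \<le> ln 2"
  shows "(\<lambda>n. renewal l n / real n * (-1) ^ n) sums (- G_fun l 1)"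
proof (cases "l = ln 2")
  case False
  \<comment> \<open>g(2) < 1 amounts to \<open>exp l < 2\<close>.\<close>
  have "exp l < exp (ln 2)" using False assms by (subst exp_less_cancel_iff) simp
  then have "g_fun l (1 + 1) < 1" using l by (simp add: g_fun_def)
  then obtain \<delta> where \<delta>: "1 < \<delta>" "g_fun l (1 + \<delta>) < 1" by (rule g_fun_less_1_extend[OF l])
  have "summable (\<lambda>n. renewal l n / real n * (-1) ^ n)"
    by (rule summable_G_series[OF l \<delta>(2)]) (use \<delta> in auto)
  moreover have "G_series l (-1) = - G_fun l 1"
    using G_fun_expansion[OF l \<delta>(2), of "-1"] \<delta> by simp
  ultimately show ?thesis unfolding G_series_def by (metis summable_sums)
next
  case True
  have g2: "g_fun l (1 + 1) = 1" using l True by (simp add: g_fun_def)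
  \<comment> \<open>The series of g has no constant term, so scaling by \<open>\<delta>\<close>
    gains at least one factor: g(1 + \<open>\<delta>\<close>) <= \<open>\<delta>\<close> *
    g(2).\<close>
  have g_lt: "g_fun l (1 + \<delta>) < 1" if "0 < \<delta>" "\<delta> < 1" for \<delta>
  proof -
    have "g_fun l (1 + \<delta>) \<le> \<delta> * g_fun l (1 + 1)"
    proof (rule sums_le[OF _ renewal_step_sums[OF l] sums_mult[OF renewal_step_sums[OF l]]])
      show "renewal_step l n * \<delta> ^ n \<le> \<delta> * (renewal_step l n * 1 ^ n)" for n
      proof (cases n)
        case (Suc m)
        have "renewal_step l n * \<delta> ^ n \<le> renewal_step l n * \<delta> ^ 1"
          using that Suc by (intro mult_left_mono power_decreasing renewal_step_nonneg l) auto
        then show ?thesis by (simp add: mult_ac)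
      qed simp
    qed
    with g2 that show ?thesis by simp
  qed
  have eq: "G_fun l (1 + y) - G_fun l 1 = G_series l y" if "-1 < y" "y < 0" for y
  proof -
    have "-y < 1" using that by simp
    then obtain \<delta> where "-y < \<delta>" "\<delta> < 1" using dense by blast
    then show ?thesis using that by (intro G_fun_expansion[OF l g_lt]) auto
  qed
  \<comment> \<open>Continuity of G at 0 turns \<open>G_fun l 0 = 0\<close> into the limit of the
    left side.\<close>
  have "G_integrand l integrable_on {0..1/2}"
    by (intro integrable_continuous_real continuous_on_G_integrand l) simp
  then have "continuous_on {0..1/2} (G_fun l)"
    unfolding G_fun_def by (rule indefinite_integral_continuous_1)
  then have "(G_fun l \<longlongrightarrow> G_fun l 0) (at_right 0)"
    by (rule continuous_on_Icc_at_rightD) simp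
  then have "((\<lambda>y. G_fun l (1 + y)) \<longlongrightarrow> 0) (at_right (-1))"
    by (simp add: filterlim_at_right_to_0[of _ _ "-1"])
  then have "((\<lambda>y. G_fun l (1 + y) - G_fun l 1) \<longlongrightarrow> 0 - G_fun l 1) (at_right (-1))"
    by (intro tendsto_intros)
  moreover have "\<forall>\<^sub>F y in at_right (-1). G_fun l (1 + y) - G_fun l 1 = G_series l y"
    using eventually_at_right_real[of "-1" "0::real"] by (auto elim!: eventually_mono simp: eq)
  ultimately have "(G_series l \<longlongrightarrow> - G_fun l 1) (at_right (-1))"
    by (simp add: tendsto_cong)
  with G_series_ln_2_at_minus_1(2) have "G_series l (-1) = - G_fun l 1"
    unfolding True by (intro tendsto_unique[OF trivial_limit_at_right_real])
  then show ?thesis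
    using summable_sums[OF G_series_ln_2_at_minus_1(1)] by (simp add: G_series_def True)
qed

section \<open>Taylor coefficients and conclusion\<close>

text \<open>Splitting off the innermost derivative lets the induction hypothesis act on
  \<open>deriv f\<close> and \<open>fps_deriv F\<close>, so both are generalised.\<close>

lemma has_fps_expansion_higher_deriv:
  fixes f :: "real \<Rightarrow> real"
  assumes "f has_fps_expansion F"
  shows "(deriv ^^ n) f 0 = fact n * fps_nth F n"
  using assms
proof (induction n arbitrary: f F)
  case 0
  then have "eval_fps F 0 = f 0"
    unfolding has_fps_expansion_def by (auto dest: eventually_nhds_x_imp_x)
  then show ?case by (simp add: eval_fps_at_0)
next
  case (Suc n)
  have "(deriv ^^ Suc n) f 0 = (deriv ^^ n) (deriv f) 0"
    by (simp only: funpow_Suc_right o_apply)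
  also have "\<dots> = fact n * fps_nth (fps_deriv F) n"
    by (rule Suc.IH[OF has_fps_expansion_deriv[OF Suc.prems]])
  finally show ?case by (simp add: algebra_simps)
qed

theorem theorem3p2:
  fixes l :: real
  assumes "0 < l" and "l < 1"
  shows "(l \<le> ln 2 \<longrightarrow> (\<forall>\<^sub>F s in nhds 1.
           (\<lambda>i. let n = Suc i in
              ((l * (s - 1)) ^ n - (- l) ^ n) / real n * (1 / fact n) * bell_sum l n) sums G_fun l s))
    \<and> G_fun l 0 = 0
    \<and> (l \<le> ln 2 \<longrightarrow>
           (\<lambda>i. let n = Suc i in (- l) ^ n / real n * (1 / fact n) * bell_sum l n) sums (- G_fun l 1))
    \<and> (\<forall>n\<ge>1. (deriv ^^ n) (G_fun l) 1 = l ^ n / real n * bell_sum l n)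
    \<and> (\<forall>\<^sub>F s in nhds 1.
           (\<lambda>i. let n = Suc i in
              b_coeff l n / real n * ((s - 1) ^ n / fact n)) sums (G_fun l s - G_fun l 1))
    \<and> (l \<le> ln 2 \<longrightarrow>
           (\<lambda>i. let n = Suc i in (- 1) ^ (n - 1) * b_coeff l n / (real n * fact n)) sums G_fun l 1)
    \<and> G_fun l 1 > 0"
proof -
  note l = assms
  \<comment> \<open>Since g(1) = 0, every \<open>l\<close> in (0, 1) admits such a disc.\<close>
  obtain \<delta> where \<delta>: "0 < \<delta>" "g_fun l (1 + \<delta>) < 1"
    by (rule g_fun_less_1_extend[OF l, of 0]) (auto simp: g_fun_def)
  \<comment> \<open>The bound by 1 ensures \<open>-1 \<le> y\<close> for
    \<open>G_fun_expansion\<close>.\<close>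
  have local0: "(\<lambda>n. renewal l n / real n * y ^ n) sums (G_fun l (1 + y) - G_fun l 1)"
    if "\<bar>y\<bar> < min \<delta> 1" for y
  proof -
    have "summable (\<lambda>n. renewal l n / real n * y ^ n)"
      by (rule summable_G_series[OF l \<delta>(2)]) (use that in auto)
    moreover have "G_fun l (1 + y) - G_fun l 1 = G_series l y"
      by (rule G_fun_expansion[OF l \<delta>(2)]) (use that in auto)
    ultimately show ?thesis
      unfolding G_series_def by (simp only: summable_sums)
  qed
  have "\<forall>\<^sub>F s in nhds (1::real). dist s 1 < min \<delta> 1"
    using \<delta> by (intro eventually_nhds_metric[THEN iffD2] exI[of _ "min \<delta> 1"]) auto
  then have loc: "\<forall>\<^sub>F s in nhds 1. (\<lambda>n. renewal l n / real n * (s - 1) ^ n) sums (G_fun l s - G_fun l 1)"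
    by (rule eventually_mono) (use local0[of "_ - 1"] in \<open>simp add: dist_real_def\<close>)
  have Suc_sums: "(\<lambda>i. f (Suc i)) sums S" if "f sums S" "f 0 = 0" for f and S :: real
    using that by (subst sums_Suc_iff) simp
  have 5: "\<forall>\<^sub>F s in nhds 1. (\<lambda>i. let n = Suc i in
              b_coeff l n / real n * ((s - 1) ^ n / fact n)) sums (G_fun l s - G_fun l 1)"
    using loc
  proof eventually_elim
    case (elim s)
    from Suc_sums[OF this] show ?case
      by (simp add: renewal_def Let_def divide_simps mult_ac del: fact_Suc of_nat_Suc)
  qed
  have at0: "(\<lambda>i. let n = Suc i in (- l) ^ n / real n * (1 / fact n) * bell_sum l n) sums (- G_fun l 1)"
    if "l \<le> ln 2"
  proof -
    have "(- l) ^ n = l ^ n * (-1) ^ n" for n by (simp flip: power_mult_distrib)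
    then show ?thesis
      using Suc_sums[OF G_series_sums_at_minus_1[OF l that]]
      by (simp add: renewal_def b_coeff_def Let_def mult_ac del: fact_Suc of_nat_Suc power_Suc)
  qed
  have 1: "\<forall>\<^sub>F s in nhds 1. (\<lambda>i. let n = Suc i in
      ((l * (s - 1)) ^ n - (- l) ^ n) / real n * (1 / fact n) * bell_sum l n) sums G_fun l s"
    if "l \<le> ln 2"
    using 5
  proof eventually_elim
    case (elim s)
    \<comment> \<open>Subtracting the series at s = 0, with sum \<open>- G_fun l 1\<close>, cancels
      the constant in the expansion at \<open>s\<close>.\<close>
    have "x * B / m * (y / f) - z / m * (1 / f) * B = (x * y - z) / m * (1 / f) * B" for x y z m f B :: real
      by (simp add: diff_divide_distrib algebra_simps)
    with sums_diff[OF elim at0[OF that]] show ?case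
      by (simp only: b_coeff_def Let_def power_mult_distrib diff_add_cancel diff_minus_eq_add)
  qed
  have 6: "(\<lambda>i. let n = Suc i in (- 1) ^ (n - 1) * b_coeff l n / (real n * fact n)) sums G_fun l 1"
    if "l \<le> ln 2"
    using sums_minus[OF Suc_sums[OF G_series_sums_at_minus_1[OF l that]]]
    by (simp add: renewal_def Let_def mult_ac del: fact_Suc of_nat_Suc)
  have 4: "(deriv ^^ n) (G_fun l) 1 = l ^ n / real n * bell_sum l n" if "n \<ge> 1" for n
  proof -
    \<comment> \<open>For n >= 1 the constant \<open>G_fun l 1\<close> does not affect the
      coefficient, and \<open>fact n\<close> cancels the factorial in
      \<open>renewal\<close>.\<close>
    define F where "F = Abs_fps (\<lambda>n. renewal l n / real n) + fps_const (G_fun l 1)"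
    have "(\<lambda>y. (G_fun l (1 + y) - G_fun l 1) + G_fun l 1) has_fps_expansion F"
      unfolding F_def
    proof (intro has_fps_expansion_add has_fps_expansion_const has_fps_expansionI)
      have "\<forall>\<^sub>F y in nhds (0::real). dist y 0 < min \<delta> 1"
        using \<delta> by (intro eventually_nhds_metric[THEN iffD2] exI[of _ "min \<delta> 1"]) auto
      then show "\<forall>\<^sub>F y in nhds 0. (\<lambda>n. fps_nth (Abs_fps (\<lambda>n. renewal l n / real n)) n * y ^ n)
          sums (G_fun l (1 + y) - G_fun l 1)"
        by (rule eventually_mono) (use local0 in \<open>simp add: dist_real_def\<close>)
    qed
    then have "(\<lambda>y. G_fun l (1 + y)) has_fps_expansion F" by simp
    from has_fps_expansion_higher_deriv[OF this, of n]
    have "(deriv ^^ n) (G_fun l) 1 = fact n * fps_nth F n"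
      by (subst higher_deriv_shift_0) (simp add: o_def)
    then show ?thesis
      using that by (simp add: F_def renewal_def b_coeff_def)
  qed
  show ?thesis
    using 1 at0 4 5 6 G_fun_pos[OF l] by simp
qed

end
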